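(* Let $n\ge 1$ and let $\mathcal{G}\subseteq \mathcal{M}_n(\mathbb{C})$ be a group of unitary matrices. If $\mathcal{G}$ is $\frac{1}{2n^2}$-argument-submultiplicative, then $\mathcal{G}$ is finite modulo its centre, i.e. $\mathcal{G}/Z(\mathcal{G})$ is finite.
   Context: For a complex number $z\neq 0$, $\arg(z)\in(-\pi,\pi]$ denotes its principal argument; $\sigma(M)$ denotes the spectrum of a matrix $M$. A group $\mathcal{G}$ of unitary $n\times n$ matrices is called $\varepsilon'$-argument-submultiplicative ($\varepsilon'$-ASM) if for every $A,B\in\mathcal{G}$ and every $\gamma\in\sigma(AB)$ there exist $\alpha\in\sigma(A)$ and $\beta\in\sigma(B)$ such that $\frac{1}{2\pi}\left|\arg\left(\frac{\alpha\beta}{\gamma}\right)\right|\le \varepsilon'$. $Z(\mathcal{G})$ denotes the centre of $\mathcal{G}$. *)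

theory Defs
  imports "HOL-Analysis.Analysis"
begin

definition mat_adjoint :: "complex ^'n ^'m \<Rightarrow> complex ^'m ^'n" where
  "mat_adjoint A = (\<chi> i j. cnj (A $ j $ i))"

definition unitary :: "complex ^'n ^'n \<Rightarrow> bool" where
  "unitary U \<longleftrightarrow> U ** mat_adjoint U = mat 1 \<and> mat_adjoint U ** U = mat 1"

definition spectrum :: "complex ^'n ^'n \<Rightarrow> complex set" where
  "spectrum A = {z. \<exists>v. v \<noteq> 0 \<and> A *v v = z *s v}"

definition unitary_group :: "(complex ^'n ^'n) set \<Rightarrow> bool" where
  "unitary_group G \<longleftrightarrow> (\<forall>A\<in>G. unitary A) \<and> mat 1 \<in> G \<and>
     (\<forall>A\<in>G. \<forall>B\<in>G. A ** B \<in> G) \<and> (\<forall>A\<in>G. matrix_inv A \<in> G)"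

definition ASM :: "real \<Rightarrow> (complex ^'n ^'n) set \<Rightarrow> bool" where
  "ASM eps G \<longleftrightarrow> (\<forall>A\<in>G. \<forall>B\<in>G. \<forall>\<gamma>\<in>spectrum (A ** B).
      \<exists>\<alpha>\<in>spectrum A. \<exists>\<beta>\<in>spectrum B. \<bar>Arg (\<alpha> * \<beta> / \<gamma>)\<bar> / (2 * pi) \<le> eps)"

definition centre :: "(complex ^'n ^'n) set \<Rightarrow> (complex ^'n ^'n) set" where
  "centre G = {Z \<in> G. \<forall>A\<in>G. Z ** A = A ** Z}"

definition quotient_by_centre :: "(complex ^'n ^'n) set \<Rightarrow> (complex ^'n ^'n) set set" where
  "quotient_by_centre G = (\<lambda>A. (\<lambda>Z. A ** Z) ` centre G) ` G"

end

theory Submission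
  imports Defs "HOL-Computational_Algebra.Fundamental_Theorem_Algebra"
begin

text \<open>For \<open>g, z\<close> in the group, the commutator \<open>z g z* g*\<close> is the product of a conjugate of \<open>g\<close>
  and of \<open>g*\<close>, so its eigenvalues lie within angle \<open>pi / n^2\<close> of the at most \<open>n^2 - n + 1\<close>
  quotients of eigenvalues of \<open>g\<close>. For \<open>n \<ge> 2\<close> the corresponding arcs do not cover the circle:
  some arc, of a length depending only on \<open>n\<close>, is free of eigenvalues of \<open>z g z* g*\<close> for every \<open>z\<close>,
  and this persists for \<open>g\<close> in the closure of the group. Consequently, if \<open>x\<close> is near \<open>1\<close> and
  commutes with \<open>g x g*\<close>, then \<open>x\<close> commutes with \<open>g\<close>: otherwise \<open>c = x (g x g*)*\<close> has an
  eigenvalue near but different from \<open>1\<close>, whose powers are eigenvalues of the commutators \<open>c^k\<close>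
  of \<open>x^k\<close> and \<open>g\<close> and hit the free arc.

  Given \<open>x\<close> near \<open>1\<close>, choose \<open>g\<close> in the compact closure such that \<open>y = g x g*\<close> is as far from \<open>x\<close>
  as possible in Frobenius norm. If \<open>x y \<noteq> y x\<close>, conjugating \<open>y\<close> by \<open>x y x* y*\<close> would move it still
  farther away. So \<open>x\<close> commutes with \<open>y\<close>, hence with \<open>g\<close>, so the maximal distance is \<open>0\<close> and
  \<open>x\<close> is central. As a neighbourhood of \<open>1\<close> in the group is central, compactness finishes the proof.\<close>

section \<open>Matrix algebra and the Frobenius inner product\<close>

lemma mat_adjoint_mat_1 [simp]: "mat_adjoint (mat 1) = mat 1"
  by (auto simp: mat_adjoint_def mat_def vec_eq_iff)

lemma mat_adjoint_involutive [simp]: "mat_adjoint (mat_adjoint A) = A"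
  by (simp add: mat_adjoint_def vec_eq_iff)

lemma mat_adjoint_mult: "mat_adjoint (A ** B) = mat_adjoint B ** mat_adjoint A"
  by (simp add: mat_adjoint_def matrix_matrix_mult_def vec_eq_iff mult.commute)

lemma tendsto_matrix_mult [tendsto_intros]:
  fixes f :: "'b \<Rightarrow> complex ^'n ^'m" and g :: "'b \<Rightarrow> complex ^'k ^'n"
  assumes "(f \<longlongrightarrow> A) F" "(g \<longlongrightarrow> B) F"
  shows "((\<lambda>t. f t ** g t) \<longlongrightarrow> A ** B) F"
  unfolding matrix_matrix_mult_def
  by (intro vec_tendstoI) (simp, intro tendsto_intros assms)

lemma tendsto_matrix_vector_mult [tendsto_intros]:
  fixes f :: "'b \<Rightarrow> complex ^'n ^'m"
  assumes "(f \<longlongrightarrow> A) F"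
  shows "((\<lambda>t. f t *v v) \<longlongrightarrow> A *v v) F"
  unfolding matrix_vector_mult_def
  by (intro vec_tendstoI) (simp, intro tendsto_intros assms)

lemma tendsto_vector_scalar_mult [tendsto_intros]:
  fixes f :: "'b \<Rightarrow> complex"
  assumes "(f \<longlongrightarrow> a) F"
  shows "((\<lambda>t. f t *s v) \<longlongrightarrow> a *s v) F"
  by (intro vec_tendstoI) (simp, intro tendsto_intros assms)

lemma tendsto_mat_adjoint [tendsto_intros]:
  assumes "(f \<longlongrightarrow> A) F"
  shows "((\<lambda>t. mat_adjoint (f t)) \<longlongrightarrow> mat_adjoint A) F"
  unfolding mat_adjoint_def
  by (intro vec_tendstoI) (simp, intro tendsto_intros assms)

text \<open>The inner product throughout is the real one, the real part of the Hermitian form.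
  Complex scalars therefore move across it only by conjugation.\<close>

lemma inner_complex_eq: "(a::complex) \<bullet> b = Re (a * cnj b)"
  by (simp add: inner_complex_def)

lemma inner_scale_left: "((a *s u) :: complex ^'n) \<bullet> v = u \<bullet> (cnj a *s v)"
  by (simp add: inner_vec_def inner_complex_eq mult_ac)

lemma norm_scale: "norm ((a *s u) :: complex ^'n) = cmod a * norm u"
  by (simp add: norm_vec_def L2_set_right_distrib norm_mult)

lemma inner_matrix_vector_mult_left:
  fixes M :: "complex ^'n ^'m"
  shows "(M *v u) \<bullet> v = u \<bullet> (mat_adjoint M *v v)"
proof -
  have "(M *v u) \<bullet> v = Re (\<Sum>i\<in>UNIV. \<Sum>k\<in>UNIV. M $ i $ k * u $ k * cnj (v $ i))"
    by (simp add: inner_vec_def inner_complex_eq matrix_vector_mult_def sum_distrib_right)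
  also have "\<dots> = Re (\<Sum>k\<in>UNIV. \<Sum>i\<in>UNIV. M $ i $ k * u $ k * cnj (v $ i))"
    by (subst sum.swap) (rule refl)
  also have "\<dots> = u \<bullet> (mat_adjoint M *v v)"
    by (simp add: inner_vec_def inner_complex_eq matrix_vector_mult_def mat_adjoint_def
        sum_distrib_left mult_ac)
  finally show ?thesis .
qed

lemma inner_matrix_transpose:
  fixes A B :: "complex ^'n ^'m"
  shows "transpose A \<bullet> transpose B = A \<bullet> B"
  unfolding inner_vec_def transpose_def by simp (rule sum.swap)

lemma norm_transpose: "norm (transpose A :: complex ^'n ^'m) = norm A"
  by (simp add: norm_eq_sqrt_inner inner_matrix_transpose)

lemma transpose_mult_column: "transpose (X ** A) $ j = X *v (transpose A $ j)"
  for X :: "complex ^'n ^'m"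
  by (simp add: vec_eq_iff transpose_def matrix_matrix_mult_def matrix_vector_mult_def)

text \<open>Left multiplication acts on columns, whereas \<open>A $ i\<close> is a row. Passing to
  transposes reduces the claim to the vector case, column by column.\<close>

lemma inner_matrix_mult_left:
  fixes X :: "complex ^'n ^'m" and A :: "complex ^'k ^'n"
  shows "(X ** A) \<bullet> B = A \<bullet> (mat_adjoint X ** B)"
proof -
  have "(X ** A) \<bullet> B = transpose (X ** A) \<bullet> transpose B"
    by (simp add: inner_matrix_transpose)
  also have "\<dots> = transpose A \<bullet> transpose (mat_adjoint X ** B)"
    by (simp add: inner_vec_def[where ?'b="'k"] transpose_mult_column inner_matrix_vector_mult_left)
  finally show ?thesis by (simp add: inner_matrix_transpose)
qed

lemma inner_mat_adjoint: "mat_adjoint A \<bullet> mat_adjoint B = A \<bullet> B"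
proof -
  have "mat_adjoint A \<bullet> mat_adjoint B = transpose A \<bullet> transpose B"
    by (simp add: inner_vec_def inner_complex_def transpose_def mat_adjoint_def)
  then show ?thesis by (simp add: inner_matrix_transpose)
qed

lemma inner_matrix_mult_right:
  fixes X :: "complex ^'k ^'n" and A :: "complex ^'n ^'m"
  shows "(A ** X) \<bullet> B = A \<bullet> (B ** mat_adjoint X)"
proof -
  have "(A ** X) \<bullet> B = (mat_adjoint X ** mat_adjoint A) \<bullet> mat_adjoint B"
    by (metis inner_mat_adjoint mat_adjoint_mult)
  also have "\<dots> = mat_adjoint A \<bullet> (X ** mat_adjoint B)"
    by (simp add: inner_matrix_mult_left)
  also have "\<dots> = A \<bullet> (B ** mat_adjoint X)"
    by (metis inner_mat_adjoint mat_adjoint_mult mat_adjoint_involutive)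
  finally show ?thesis .
qed

text \<open>Cauchy-Schwarz in every row; \<open>norm\<close> on matrices is the Frobenius
  norm.\<close>

lemma norm_matrix_vector_mult_le:
  fixes A :: "complex ^'n ^'m"
  shows "norm (A *v u) \<le> norm A * norm u"
proof -
  have "norm ((A *v u) $ i) \<le> norm (A $ i) * norm u" for i
  proof -
    have "norm ((A *v u) $ i) \<le> (\<Sum>k\<in>UNIV. \<bar>cmod (A $ i $ k)\<bar> * \<bar>cmod (u $ k)\<bar>)"
      unfolding matrix_vector_mult_def by (simp add: sum_norm_le norm_mult)
    also have "\<dots> \<le> norm (A $ i) * norm u"
      unfolding norm_vec_def by (rule L2_set_mult_ineq)
    finally show ?thesis .
  qed
  then have "norm (A *v u) \<le> L2_set (\<lambda>i. norm (A $ i) * norm u) UNIV"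
    unfolding norm_vec_def[of "A *v u"] by (intro L2_set_mono) auto
  also have "\<dots> = norm A * norm u"
    by (simp add: norm_vec_def[of A] L2_set_left_distrib)
  finally show ?thesis .
qed

lemma norm_matrix_mult_le:
  fixes A :: "complex ^'n ^'m" and B :: "complex ^'k ^'n"
  shows "norm (A ** B) \<le> norm A * norm B"
proof -
  have "norm (transpose (A ** B)) \<le> L2_set (\<lambda>j. norm A * norm (transpose B $ j)) UNIV"
    unfolding norm_vec_def[of "transpose (A ** B)"]
    by (intro L2_set_mono) (auto simp: transpose_mult_column norm_matrix_vector_mult_le)
  also have "\<dots> = norm A * norm (transpose B)"
    by (simp add: norm_vec_def[of "transpose B"] L2_set_right_distrib)
  finally show ?thesis by (simp add: norm_transpose)
qed

section \<open>Unitary matrices: inverses and invariance of norms\<close>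

lemma unitary_mult: "unitary A \<Longrightarrow> unitary B \<Longrightarrow> unitary (A ** B)"
  unfolding unitary_def mat_adjoint_mult
  by (metis (no_types) matrix_mul_assoc matrix_mul_rid)

lemma unitary_adjoint: "unitary A \<Longrightarrow> unitary (mat_adjoint A)"
  by (simp add: unitary_def)

lemma unitary_cancel:
  assumes "unitary U"
  shows "U ** mat_adjoint U = mat 1" "mat_adjoint U ** U = mat 1"
    "U ** (mat_adjoint U ** A) = A" "mat_adjoint U ** (U ** A) = A"
  using assms by (simp_all add: unitary_def matrix_mul_assoc)

text \<open>Replaces the inverse in \<open>unitary_group\<close> by the adjoint, which is given
  entrywise and hence visibly continuous.\<close>

lemma matrix_inv_unitary:
  assumes "unitary A"
  shows "matrix_inv A = mat_adjoint A"
proof -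
  have "A ** matrix_inv A = mat 1 \<and> matrix_inv A ** A = mat 1"
    unfolding matrix_inv_def using assms unfolding unitary_def by (rule someI)
  then have "mat_adjoint A ** (A ** matrix_inv A) = mat_adjoint A"
    by simp
  then show ?thesis
    by (simp add: unitary_cancel(4)[OF assms])
qed

lemma norm_unitary_mult_left: "unitary U \<Longrightarrow> norm (U ** A) = norm A"
  by (simp add: norm_eq_sqrt_inner inner_matrix_mult_left unitary_cancel)

lemma norm_unitary_mult_right: "unitary U \<Longrightarrow> norm (A ** U) = norm A"
  by (simp add: norm_eq_sqrt_inner inner_matrix_mult_right unitary_cancel
      flip: matrix_mul_assoc)

lemma unitary_vector_cancel:
  "unitary U \<Longrightarrow> U *v (mat_adjoint U *v v) = v"
  "unitary U \<Longrightarrow> mat_adjoint U *v (U *v v) = v"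
  by (simp_all add: matrix_vector_mul_assoc unitary_cancel)

lemma norm_unitary_vector: "unitary U \<Longrightarrow> norm (U *v v) = norm v"
  by (simp add: norm_eq_sqrt_inner inner_matrix_vector_mult_left unitary_vector_cancel)

section \<open>Spectral theory of unitary matrices\<close>

lemma norm_eigenvalue_unitary:
  assumes "unitary M" "M *v u = l *s u" "u \<noteq> 0"
  shows "cmod l = 1"
  using norm_unitary_vector[OF assms(1), of u] assms by (simp add: norm_scale)

lemma adjoint_eigenvector:
  assumes "unitary M" "M *v u = l *s u" "u \<noteq> 0"
  shows "mat_adjoint M *v u = cnj l *s u"
proof -
  have "cnj l * l = 1"
    using norm_eigenvalue_unitary[OF assms]
    by (metis complex_norm_square mult.commute of_real_1 one_power2)
  moreover have "u = l *s (mat_adjoint M *v u)"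
    using unitary_vector_cancel(2)[OF assms(1), of u] assms(2)
    by (simp add: vec.scale)
  ultimately show ?thesis
    by (metis vector_smult_assoc vector_smult_lid)
qed

text \<open>Applying \<open>M\<close> to both vectors preserves the inner product but multiplies one
  side by \<open>c = l * cnj m\<close>, which differs from \<open>1\<close>. Since the inner product
  is only real, this is shown for every complex multiple \<open>a *s u\<close>, and
  \<open>a = 1 / (1 - c)\<close> then isolates the claim.\<close>

lemma eigenvectors_orthogonal:
  assumes M: "unitary M" and u: "M *v u = l *s u" and v: "M *v v = m *s v" and "l \<noteq> m"
  shows "u \<bullet> v = 0"
proof (cases "v = 0")
  case False
  define c where "c = l * cnj m"
  have mm: "cnj m * m = 1"
    using norm_eigenvalue_unitary[OF M v False]
    by (metis complex_norm_square mult.commute of_real_1 one_power2)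
  have "c \<noteq> 1"
  proof
    assume "c = 1"
    then have "l * (cnj m * m) = m" by (simp add: c_def flip: mult.assoc)
    with mm \<open>l \<noteq> m\<close> show False by simp
  qed
  have "(a *s u) \<bullet> v = ((c * a) *s u) \<bullet> v" for a
  proof -
    have "(a *s u) \<bullet> v = (M *v (a *s u)) \<bullet> (M *v v)"
      by (simp add: inner_matrix_vector_mult_left unitary_vector_cancel M)
    also have "\<dots> = ((c * a) *s u) \<bullet> v"
      by (simp add: vec.scale u v c_def inner_scale_left mult_ac)
    finally show ?thesis .
  qed
  then have "(((1 - c) * a) *s u) \<bullet> v = 0" for a
    by (simp add: left_diff_distrib vec.scale_left_diff_distrib inner_diff_left)
  from this[of "1 / (1 - c)"] \<open>c \<noteq> 1\<close> show ?thesis by simp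
qed simp

text \<open>Induction on a degree bound for a polynomial annihilating \<open>v\<close>: split off a
  root \<open>z\<close> and put \<open>v' = M *v v - z *s v\<close>. Either \<open>v' = 0\<close>
  and \<open>v\<close> is an eigenvector, or the cofactor \<open>q\<close> annihilates the nonzero
  vector \<open>v'\<close>, which still lies in \<open>W\<close>.\<close>

lemma eigenvector_of_polynomial:
  fixes M :: "complex ^'n ^'n"
  assumes W: "\<And>u l. u \<in> W \<Longrightarrow> M *v u - l *s u \<in> W"
  shows "p \<noteq> 0 \<Longrightarrow> degree p \<le> N \<Longrightarrow> (\<Sum>i\<le>N. coeff p i *s (((*v) M) ^^ i) v) = 0 \<Longrightarrow>
    v \<in> W \<Longrightarrow> v \<noteq> 0 \<Longrightarrow> \<exists>u\<in>W. u \<noteq> 0 \<and> (\<exists>l. M *v u = l *s u)"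
proof (induction N arbitrary: p v)
  case 0
  then have "coeff p 0 *s v = 0" "coeff p 0 \<noteq> 0"
    using leading_coeff_0_iff[of p] by auto
  with \<open>v \<noteq> 0\<close> show ?case by simp
next
  case (Suc N)
  show ?case
  proof (cases "degree p = 0")
    case True
    have "(\<Sum>i\<le>Suc N. coeff p i *s (((*v) M) ^^ i) v) = coeff p 0 *s v"
      using True by (subst sum.atMost_Suc_shift) (simp add: coeff_eq_0)
    with Suc.prems True show ?thesis by (metis leading_coeff_0_iff vec.scale_eq_0_iff)
  next
    case False
    then obtain z where "poly p z = 0"
      using fundamental_theorem_of_algebra[of p] by (auto simp: constant_degree)
    then obtain q where q: "p = [:-z, 1:] * q"
      by (metis dvd_def poly_eq_0_iff_dvd)
    have q0: "q \<noteq> 0" using q Suc.prems(1) by auto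
    then have "degree p = Suc (degree q)"
      unfolding q by (subst degree_mult_eq) auto
    with Suc.prems(2) have dq: "degree q \<le> N" by simp
    define T where "T = (*v) M"
    define v' where "v' = M *v v - z *s v"
    have T_diff: "(T ^^ i) (a - b) = (T ^^ i) a - (T ^^ i) b" for i a b
      by (induction i) (auto simp: T_def vec.diff)
    have T_scale: "(T ^^ i) (c *s a) = c *s (T ^^ i) a" for i a c
      by (induction i) (auto simp: T_def vec.scale)
    have p: "p = pCons 0 q - smult z q" by (simp add: q)
    have "(\<Sum>i\<le>Suc N. coeff p i *s (T ^^ i) v)
        = (\<Sum>i\<le>Suc N. coeff (pCons 0 q) i *s (T ^^ i) v) - (\<Sum>i\<le>Suc N. z *s (coeff q i *s (T ^^ i) v))"
      by (simp add: p sum_subtractf vec.scale_left_diff_distrib)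
    also have "(\<Sum>i\<le>Suc N. coeff (pCons 0 q) i *s (T ^^ i) v) = (\<Sum>i\<le>N. coeff q i *s (T ^^ i) (T v))"
      by (subst sum.atMost_Suc_shift) (simp add: funpow_swap1)
    also have "(\<Sum>i\<le>Suc N. z *s (coeff q i *s (T ^^ i) v)) = (\<Sum>i\<le>N. z *s (coeff q i *s (T ^^ i) v))"
      using dq by (simp add: coeff_eq_0)
    also have "(\<Sum>i\<le>N. coeff q i *s (T ^^ i) (T v)) - (\<Sum>i\<le>N. z *s (coeff q i *s (T ^^ i) v))
       = (\<Sum>i\<le>N. coeff q i *s (T ^^ i) v')"
      by (simp add: v'_def T_diff T_scale sum_subtractf vec.scale_right_diff_distrib
          mult_ac flip: T_def)
    finally have "(\<Sum>i\<le>N. coeff q i *s (T ^^ i) v') = 0"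
      using Suc.prems(3) by (simp add: T_def)
    moreover have "v' \<in> W" unfolding v'_def using W Suc.prems(4) by blast
    ultimately show ?thesis
      using Suc.IH[of q v'] q0 dq Suc.prems(4,5)
      by (cases "v' = 0") (auto simp: v'_def T_def)
  qed
qed

text \<open>The \<open>N + 1\<close> vectors \<open>v, M v, ..., M^N v\<close> in dimension
  \<open>N\<close> yield an annihilating polynomial. If they are distinct, a linear dependence
  supplies its coefficients; if two coincide, a difference of two monomials does.\<close>

lemma eigenvector_in_invariant_set:
  fixes M :: "complex ^'n ^'n"
  assumes W: "\<And>u l. u \<in> W \<Longrightarrow> M *v u - l *s u \<in> W" and v: "v \<in> W" "v \<noteq> 0"
  shows "\<exists>u\<in>W. u \<noteq> 0 \<and> (\<exists>l. M *v u = l *s u)"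
proof -
  define N where "N = CARD('n)"
  define f where "f = (\<lambda>i. (((*v) M) ^^ i) v)"
  have "\<exists>p. p \<noteq> 0 \<and> degree p \<le> N \<and> (\<Sum>i\<le>N. coeff p i *s f i) = 0"
  proof (cases "inj_on f {..N}")
    case True
    then have "card (f ` {..N}) = Suc N" by (simp add: card_image)
    then have "vec.dependent (f ` {..N})"
      using vec.independent_card_le_dim[of "f ` {..N}" UNIV]
      by (auto simp: vec_dim_card N_def simp del: vec.dim_UNIV)
    then obtain c w where c: "w \<in> f ` {..N}" "c w \<noteq> 0" "(\<Sum>x\<in>f ` {..N}. c x *s x) = 0"
      by (subst (asm) vec.dependent_finite) auto
    define p where "p = (\<Sum>i\<le>N. monom (c (f i)) i)"
    have coeff: "coeff p i = (if i \<le> N then c (f i) else 0)" for i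
      by (simp add: p_def coeff_sum)
    have "p \<noteq> 0" using c(1,2) coeff by (metis (no_types, lifting) atMost_iff coeff_0 imageE)
    moreover have "degree p \<le> N" by (rule degree_le) (simp add: coeff)
    moreover have "(\<Sum>i\<le>N. coeff p i *s f i) = 0"
      using c(3) by (simp add: sum.reindex[OF True] coeff)
    ultimately show ?thesis by blast
  next
    case False
    then obtain i j where ij: "i \<le> N" "j \<le> N" "i \<noteq> j" "f i = f j"
      by (auto simp: inj_on_def)
    define p :: "complex poly" where "p = monom 1 i - monom 1 j"
    have "coeff p i = 1" using ij by (simp add: p_def)
    then have "p \<noteq> 0" by auto
    moreover have "degree p \<le> N" using ij by (intro degree_le) (auto simp: p_def)
    moreover have "(\<Sum>k\<le>N. coeff p k *s f k) =
      (\<Sum>k\<le>N. if k = i then f k else 0) - (\<Sum>k\<le>N. if k = j then f k else 0)"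
      unfolding sum_subtractf[symmetric] using ij
      by (intro sum.cong) (auto simp: p_def vec.scale_left_diff_distrib)
    then have "(\<Sum>k\<le>N. coeff p k *s f k) = 0"
      using ij by simp
    ultimately show ?thesis by blast
  qed
  then show ?thesis
    using eigenvector_of_polynomial[of W M _ N v, OF W] v unfolding f_def by blast
qed

text \<open>Eigenvectors of \<open>M\<close> are stable under its adjoint and under complex scaling,
  so their orthogonal complement is stable under \<open>M - l\<close>. A nonzero complement would
  contain an eigenvector, which would be orthogonal to itself.\<close>

lemma span_eigenvectors_unitary:
  fixes M :: "complex ^'n ^'n"
  assumes M: "unitary M"
  shows "span {u. \<exists>l. M *v u = l *s u} = UNIV"
proof (rule ccontr)
  let ?E = "{u. \<exists>l. M *v u = l *s u}"
  assume "span ?E \<noteq> UNIV"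
  then obtain a where a: "a \<noteq> 0" "\<forall>x\<in>span ?E. a \<bullet> x = 0"
    using span_not_UNIV_orthogonal by blast
  let ?W = "{u. \<forall>e\<in>?E. u \<bullet> e = 0}"
  have scale: "c *s e \<in> ?E" if "e \<in> ?E" for c e
    using that by (auto simp: vec.scale mult.commute)
  have adj: "mat_adjoint M *v e \<in> ?E" if "e \<in> ?E" for e
  proof (cases "e = 0")
    case True
    then show ?thesis by auto
  next
    case False
    then obtain l where "mat_adjoint M *v e = l *s e"
      using adjoint_eigenvector[OF M] \<open>e \<in> ?E\<close> by blast
    then show ?thesis using scale[OF that] by simp
  qed
  have "\<exists>u\<in>?W. u \<noteq> 0 \<and> (\<exists>l. M *v u = l *s u)"
  proof (rule eigenvector_in_invariant_set)
    show "a \<in> ?W" using a(2) by (auto intro: span_base)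
    fix u l assume u: "u \<in> ?W"
    show "M *v u - l *s u \<in> ?W"
    proof safe
      fix e m assume "M *v e = m *s e"
      then have "e \<in> ?E" by blast
      then show "(M *v u - l *s u) \<bullet> e = 0"
        using u adj scale by (simp only: inner_diff_left inner_matrix_vector_mult_left inner_scale_left) simp
    qed
  qed (fact a(1))
  then show False by fastforce
qed

text \<open>Eigenvectors for distinct eigenvalues are orthogonal, hence independent. This bounds
  every finite subset of the spectrum by the dimension.\<close>

lemma finite_spectrum_unitary:
  fixes M :: "complex ^'n ^'n"
  assumes M: "unitary M"
  shows "finite (spectrum M)" "card (spectrum M) \<le> CARD('n)"
proof -
  have "card T \<le> CARD('n)" if T: "T \<subseteq> spectrum M" "finite T" for T
  proof -
    have "\<forall>l\<in>T. \<exists>v. v \<noteq> 0 \<and> M *v v = l *s v"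
      using T(1) by (auto simp: spectrum_def)
    then obtain v where v: "\<And>l. l \<in> T \<Longrightarrow> v l \<noteq> 0 \<and> M *v v l = l *s v l"
      by metis
    have inj: "inj_on v T"
      by (rule inj_onI) (metis v vec.scale_right_imp_eq)
    have "vec.independent (v ` T)"
    proof (rule vec.independent_if_scalars_zero)
      fix f x assume sum: "(\<Sum>x\<in>v ` T. f x *s x) = 0" and "x \<in> v ` T"
      then obtain l where l: "l \<in> T" "x = v l" by auto
      let ?g = "\<lambda>m. f (v m) *s v m"
      have "0 = (\<Sum>m\<in>T. ?g m) \<bullet> ?g l"
        using sum by (simp add: sum.reindex[OF inj])
      also have "\<dots> = (\<Sum>m\<in>T. if m = l then ?g l \<bullet> ?g l else 0)"
        unfolding inner_sum_left
      proof (rule sum.cong)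
        fix m assume "m \<in> T"
        moreover have "?g m \<bullet> ?g l = 0" if "m \<noteq> l"
          by (rule eigenvectors_orthogonal[OF M _ _ that])
             (use v l \<open>m \<in> T\<close> in \<open>auto simp: vec.scale mult.commute\<close>)
        ultimately show "?g m \<bullet> ?g l = (if m = l then ?g l \<bullet> ?g l else 0)" by auto
      qed simp
      also have "\<dots> = ?g l \<bullet> ?g l" using l T(2) by simp
      finally show "f x = 0" using v[OF l(1)] l by simp
    qed (use T in auto)
    then show ?thesis
      using vec.independent_card_le_dim[of "v ` T" UNIV]
      by (simp add: vec_dim_card card_image[OF inj] del: vec.dim_UNIV)
  qed
  then show "finite (spectrum M)" "card (spectrum M) \<le> CARD('n)"
    using finite_if_finite_subsets_card_bdd[of "spectrum M"] by blast+
qed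

text \<open>Induction over the real span of the eigenvectors: each new summand is absorbed into the
  component \<open>p l\<close> of its own eigenvalue.\<close>

lemma spectral_decomposition_unitary:
  fixes M :: "complex ^'n ^'n"
  assumes M: "unitary M"
  shows "\<exists>p. (\<forall>l\<in>spectrum M. M *v p l = l *s p l) \<and> v = (\<Sum>l\<in>spectrum M. p l)"
proof -
  have fin: "finite (spectrum M)" by (rule finite_spectrum_unitary[OF M])
  have "v \<in> span {u. \<exists>l. M *v u = l *s u}"
    by (simp add: span_eigenvectors_unitary[OF M])
  then show ?thesis
  proof (induction rule: span_induct_alt)
    case base
    show ?case by (rule exI[of _ "\<lambda>_. 0"]) simp
  next
    case (step c x y)
    then obtain l p where x: "M *v x = l *s x"
      and p: "\<forall>l\<in>spectrum M. M *v p l = l *s p l" "y = (\<Sum>l\<in>spectrum M. p l)"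
      by auto
    show ?case
    proof (cases "x = 0")
      case True
      then show ?thesis using p by auto
    next
      case False
      then have l: "l \<in> spectrum M" using x by (auto simp: spectrum_def)
      let ?q = "p(l := c *\<^sub>R x + p l)"
      have "c *\<^sub>R x = complex_of_real c *s x"
        by (simp add: vec_eq_iff complex_eq_iff)
      then have "\<forall>m\<in>spectrum M. M *v ?q m = m *s ?q m"
        using p(1) x by (auto simp: vec.add vec.scale vec.scale_right_distrib mult.commute)
      moreover have "c *\<^sub>R x + y = (\<Sum>m\<in>spectrum M. ?q m)"
        unfolding p(2) using fin l by (simp add: sum.remove[OF fin l])
      ultimately show ?thesis by blast
    qed
  qed
qed

text \<open>The components of \<open>v\<close> for different eigenvalues are orthogonal, so
  Pythagoras applies both to \<open>v\<close> and to the residual. This inequality expresses that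
  the spectrum avoids a disc around \<open>w\<close> in a form that passes to limits of
  matrices.\<close>

lemma norm_residual_unitary:
  fixes M :: "complex ^'n ^'n"
  assumes M: "unitary M" and d: "\<And>l. l \<in> spectrum M \<Longrightarrow> d \<le> cmod (l - w)" "0 \<le> d"
  shows "d * norm v \<le> norm (M *v v - w *s v)"
proof -
  obtain p where p: "\<And>l. l \<in> spectrum M \<Longrightarrow> M *v p l = l *s p l" "v = (\<Sum>l\<in>spectrum M. p l)"
    using spectral_decomposition_unitary[OF M] by metis
  have fin: "finite (spectrum M)" by (rule finite_spectrum_unitary[OF M])
  have orth: "pairwise (\<lambda>i j. orthogonal (c i *s p i) (c j *s p j)) (spectrum M)" for c
    by (rule pairwiseI, unfold orthogonal_def, rule eigenvectors_orthogonal[OF M])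
       (use p(1) in \<open>auto simp: vec.scale mult.commute\<close>)
  have "M *v v - w *s v = (\<Sum>l\<in>spectrum M. (l - w) *s p l)"
    by (simp add: p vec.sum vec.scale_sum_right vec.scale_left_diff_distrib sum_subtractf)
  then have "(norm (M *v v - w *s v))\<^sup>2 = (\<Sum>l\<in>spectrum M. (cmod (l - w) * norm (p l))\<^sup>2)"
    using norm_sum_Pythagorean[OF fin orth[of "\<lambda>l. l - w"]]
    by (simp add: norm_scale del: vector_sub_rdistrib)
  also have "\<dots> \<ge> (\<Sum>l\<in>spectrum M. (d * norm (p l))\<^sup>2)"
    by (intro sum_mono power_mono mult_right_mono) (use d in auto)
  also have "(\<Sum>l\<in>spectrum M. (d * norm (p l))\<^sup>2) = (d * norm v)\<^sup>2"
    using norm_sum_Pythagorean[OF fin orth[of "\<lambda>_. 1"]] p(2)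
    by (simp add: power_mult_distrib sum_distrib_left)
  finally show ?thesis by (rule power2_le_imp_le) simp
qed

lemma unitary_eq_one:
  assumes M: "unitary M" and "\<And>l. l \<in> spectrum M \<Longrightarrow> l = 1"
  shows "M = mat 1"
proof -
  have "M *v v = mat 1 *v v" for v
  proof -
    obtain p where p: "\<forall>l\<in>spectrum M. M *v p l = l *s p l" "v = (\<Sum>l\<in>spectrum M. p l)"
      using spectral_decomposition_unitary[OF M] by metis
    have "M *v v = (\<Sum>l\<in>spectrum M. M *v p l)" by (simp add: p(2) vec.sum)
    also have "\<dots> = (\<Sum>l\<in>spectrum M. p l)"
      by (intro sum.cong refl) (metis assms(2) p(1) vector_smult_lid)
    finally show ?thesis using p(2) by simp
  qed
  then show ?thesis by (metis matrix_eq)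
qed

section \<open>Conjugation by commutators near the identity\<close>

text \<open>Polarisation: for vectors of fixed norm, a larger distance is the same as a smaller
  inner product.\<close>

lemma inner_eq_of_norm_diff: "a \<bullet> b = ((norm a)\<^sup>2 + (norm b)\<^sup>2 - (norm (a - b))\<^sup>2) / 2"
  for a b :: "'a::real_inner"
  by (simp add: power2_norm_eq_inner inner_diff_left inner_diff_right inner_commute)

lemma matrix_mult_diff_left: "(A - B) ** C = A ** C - B ** C"
  and matrix_mult_diff_right: "C ** (A - B) = C ** A - C ** B"
  for A B C :: "complex ^'n ^'n"
  by (simp_all add: vec_eq_iff matrix_matrix_mult_def left_diff_distrib right_diff_distrib sum_subtractf)

lemma norm_unitary_conj_diff_one:
  assumes "unitary g"
  shows "norm (g ** x ** mat_adjoint g - mat 1) = norm (x - mat 1)"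
proof -
  have "g ** x ** mat_adjoint g - mat 1 = g ** (x - mat 1) ** mat_adjoint g"
    using assms by (simp add: matrix_mult_diff_left matrix_mult_diff_right unitary_cancel)
  then show ?thesis
    using assms by (simp add: norm_unitary_mult_left norm_unitary_mult_right unitary_adjoint)
qed

lemma norm_adjoint_diff_one:
  assumes "unitary x"
  shows "norm (mat_adjoint x - mat 1) = norm (x - mat 1)"
proof -
  have "mat_adjoint x - mat 1 = mat_adjoint x ** (mat 1 - x)"
    using assms by (simp add: matrix_mult_diff_right unitary_cancel)
  then show ?thesis
    using assms by (simp add: norm_unitary_mult_left unitary_adjoint norm_minus_commute)
qed

text \<open>To leading order the inner product changes by \<open>- (norm (x y - y x))^2\<close>; the errors are
  smaller by a factor of the order of the distances of \<open>x\<close> and \<open>y\<close> from \<open>1\<close>.\<close>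
lemma inner_conj_commutator_less:
  fixes x y :: "complex ^'n ^'n"
  assumes x: "unitary x" and y: "unitary y"
    and ex: "norm (x - mat 1) \<le> 1/4" and ey: "norm (y - mat 1) \<le> 1/4"
    and ne: "x ** y \<noteq> y ** x"
  defines "k \<equiv> x ** y ** mat_adjoint x ** mat_adjoint y"
  shows "x \<bullet> (k ** y ** mat_adjoint k) < x \<bullet> y"
proof -
  let ?x = "mat_adjoint x" and ?y = "mat_adjoint y"
  define K where "K = x ** y - y ** x"
  define K' where "K' = k - mat 1"
  define R where "R = K' ** y - y ** K'"
  note U = unitary_cancel[OF x] unitary_cancel[OF y]
  have k: "unitary k" unfolding k_def by (intro unitary_mult unitary_adjoint x y)
  have K0: "norm K > 0" using ne by (simp add: K_def)
  have K': "K' = K ** ?x ** ?y"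
    by (simp add: K'_def K_def k_def matrix_mult_diff_left U flip: matrix_mul_assoc)
  have nK': "norm K' = norm K"
    unfolding K' by (simp add: norm_unitary_mult_right unitary_adjoint x y)
  \<comment> \<open>Subtracting \<open>mat 1\<close> from \<open>y\<close> leaves the commutator
    with \<open>K'\<close> unchanged and brings in the small factor \<open>1/4\<close>.\<close>
  have R: "R = K' ** (y - mat 1) - (y - mat 1) ** K'"
    by (simp add: R_def matrix_mult_diff_left matrix_mult_diff_right)
  have "norm R \<le> norm K' * norm (y - mat 1) + norm (y - mat 1) * norm K'"
    unfolding R by (rule order.trans[OF norm_triangle_ineq4]) (intro add_mono norm_matrix_mult_le)
  also have "\<dots> \<le> norm K / 2"
    using ey K0 mult_left_mono[OF ey, of "norm K"] by (simp add: nK' mult.commute)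
  finally have nR: "norm R \<le> norm K / 2" .
  have "k ** y ** mat_adjoint k - y = R ** mat_adjoint k"
    by (simp add: R_def K'_def matrix_mult_diff_left matrix_mult_diff_right unitary_cancel[OF k]
        flip: matrix_mul_assoc)
  then have "x \<bullet> (k ** y ** mat_adjoint k) - x \<bullet> y = x \<bullet> (R ** mat_adjoint k)"
    by (metis inner_diff_right)
  also have "\<dots> = (x ** k) \<bullet> R"
    by (simp add: inner_matrix_mult_right)
  also have "\<dots> = (x ** K') \<bullet> R + x \<bullet> R"
    by (simp add: K'_def matrix_mult_diff_right inner_diff_left)
  also have "(x ** K') \<bullet> R \<le> norm K * (norm K / 2)"
    by (rule order.trans[OF norm_cauchy_schwarz])
       (use nR K0 in \<open>simp add: norm_unitary_mult_left x nK'\<close>)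
  also have "x \<bullet> R = - ((?y ** K) \<bullet> (K ** ?x))"
  proof -
    \<comment> \<open>Moving the factors \<open>y\<close> over to \<open>x\<close> yields the
      commutator of \<open>x\<close> with the adjoint of \<open>y\<close>, which is again
      \<open>K\<close> up to sign and unitary factors.\<close>
    have "x \<bullet> R = (x ** ?y) \<bullet> K' - (?y ** x) \<bullet> K'"
      by (simp add: R_def inner_diff_right inner_matrix_mult_right[of x ?y K'] inner_matrix_mult_left[of ?y x K'])
    also have "\<dots> = (x ** ?y - ?y ** x) \<bullet> K'" by (simp add: inner_diff_left)
    also have "x ** ?y - ?y ** x = - (?y ** K ** ?y)"
      by (simp add: K_def matrix_mult_diff_left matrix_mult_diff_right U flip: matrix_mul_assoc)
    also have "(- (?y ** K ** ?y)) \<bullet> K' = - ((?y ** K) \<bullet> (K' ** y))"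
      by (simp add: inner_matrix_mult_right[of "?y ** K" ?y K'])
    also have "K' ** y = K ** ?x"
      by (simp add: K' U flip: matrix_mul_assoc)
    finally show ?thesis .
  qed
  \<comment> \<open>Both factors have the norm of \<open>K\<close> and differ by at most half of it,
    so polarisation gives \<open>(1 + 1 - 1/4) / 2 = 7/8\<close>. The other term contributes at most
    \<open>1/2\<close>, which leaves a decrease of \<open>3/8\<close>.\<close>
  also have "- ((?y ** K) \<bullet> (K ** ?x)) \<le> - (7/8 * (norm K)\<^sup>2)"
  proof -
    have "?y ** K - K ** ?x = (?y - mat 1) ** K - K ** (?x - mat 1)"
      by (simp add: matrix_mult_diff_left matrix_mult_diff_right)
    also have "norm \<dots> \<le> norm (?y - mat 1) * norm K + norm K * norm (?x - mat 1)"
      by (rule order.trans[OF norm_triangle_ineq4]) (intro add_mono norm_matrix_mult_le)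
    also have "\<dots> \<le> norm K / 2"
      using mult_left_mono[OF ey, of "norm K"] mult_left_mono[OF ex, of "norm K"]
      by (simp add: norm_adjoint_diff_one x y mult.commute)
    finally have "(norm (?y ** K - K ** ?x))\<^sup>2 \<le> (norm K / 2)\<^sup>2"
      by (rule power_mono) simp
    then show ?thesis
      by (subst inner_eq_of_norm_diff)
         (simp add: norm_unitary_mult_left norm_unitary_mult_right unitary_adjoint x y power_divide)
  qed
  finally have "x \<bullet> (k ** y ** mat_adjoint k) - x \<bullet> y \<le> - (3/8 * (norm K)\<^sup>2)"
    by (simp add: power2_eq_square)
  moreover have "(norm K)\<^sup>2 > 0" using K0 by simp
  ultimately show ?thesis by linarith
qed

section \<open>Points on the unit circle\<close>

lemma norm_cis_diff_le: "cmod (cis a - cis b) \<le> \<bar>a - b\<bar>"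
proof -
  have "cis a - cis b = cis b * (cis (a - b) - 1)"
    by (simp add: right_diff_distrib cis_mult)
  then have "cmod (cis a - cis b) = 2 * \<bar>sin ((a - b) / 2)\<bar>"
    using dist_exp_i_1[of "a - b"] by (simp add: norm_mult cis_conv_exp)
  then show ?thesis using abs_sin_x_le_abs_x[of "(a - b) / 2"] by simp
qed

lemma cis_Arg_unit: "cmod z = 1 \<Longrightarrow> cis (Arg z) = z"
  using cis_Arg[of z] by (cases "z = 0") (auto simp: sgn_eq)

text \<open>The powers advance around the circle in steps of length at most
  \<open>\<bar>\<phi>\<bar>\<close>, so they cannot jump over a neighbourhood of \<open>w\<close> of
  that radius.\<close>

lemma cis_powers_dense:
  assumes "\<phi> \<noteq> 0" "cmod w = 1"
  shows "\<exists>k. cmod (cis \<phi> ^ k - w) \<le> \<bar>\<phi>\<bar>"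
proof -
  \<comment> \<open>The full turn gives the angle of \<open>w\<close> the sign of
    \<open>\<phi>\<close>, which makes the exponent \<open>\<lfloor>t / \<phi>\<rfloor>\<close>
    nonnegative.\<close>
  define t where "t = (if \<phi> > 0 then Arg w + 2 * pi else Arg w - 2 * pi)"
  have w: "w = cis t"
    using cis_Arg_unit[OF assms(2)] by (simp add: t_def flip: cis_mult cis_divide)
  have pos: "t / \<phi> \<ge> 0"
    using assms(1) mpi_less_Arg[of w] Arg_le_pi[of w]
    by (auto simp: t_def zero_le_divide_iff)
  define k where "k = nat \<lfloor>t / \<phi>\<rfloor>"
  have "\<bar>real k - t / \<phi>\<bar> \<le> 1"
    using pos unfolding k_def by (simp add: abs_le_iff) linarith
  then have "\<bar>(real k - t / \<phi>) * \<phi>\<bar> \<le> \<bar>\<phi>\<bar>"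
    unfolding abs_mult by (simp add: mult_left_le_one_le)
  then have "\<bar>real k * \<phi> - t\<bar> \<le> \<bar>\<phi>\<bar>"
    using assms(1) by (simp add: left_diff_distrib)
  then have "cmod (cis \<phi> ^ k - w) \<le> \<bar>\<phi>\<bar>"
    unfolding w Complex.DeMoivre using norm_cis_diff_le[of "real k * \<phi>" t] by linarith
  then show ?thesis ..
qed

lemma Arg_small_near_one:
  assumes "e > 0"
  shows "\<exists>d>0. \<forall>z. cmod (z - 1) < d \<longrightarrow> \<bar>Arg z\<bar> < e"
proof -
  have "isCont Arg 1" by (rule continuous_at_Arg) simp
  then obtain d where "d > 0" "\<forall>z. dist z 1 < d \<longrightarrow> dist (Arg z) (Arg 1) < e"
    using assms unfolding continuous_at_eps_delta by blast
  then show ?thesis by (auto simp: dist_norm)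
qed

text \<open>Otherwise walking from each point of \<open>D\<close> to another one less than \<open>2 * pi / m\<close> ahead
  revisits a point after at most \<open>m\<close> steps, before completing a full turn.\<close>
lemma circle_gap:
  assumes D: "finite D" "D \<noteq> {}" "card D \<le> m" "\<And>d. d \<in> D \<Longrightarrow> cmod d = 1"
  shows "\<exists>w. cmod w = 1 \<and> (\<forall>d\<in>D. \<forall>t. \<bar>t\<bar> < pi / m \<longrightarrow> w \<noteq> d * cis t)"
proof -
  have m: "m > 0" using D by (metis card_gt_0_iff less_le_trans)
  have "\<exists>d\<in>D. \<forall>t. 0 < t \<and> t < 2 * pi / m \<longrightarrow> d * cis t \<notin> D"
  proof (rule ccontr)
    assume "\<not> ?thesis"
    then have "\<forall>d\<in>D. \<exists>t. 0 < t \<and> t < 2 * pi / m \<and> d * cis t \<in> D" by blast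
    then obtain \<tau> where \<tau>: "\<And>d. d \<in> D \<Longrightarrow> 0 < \<tau> d \<and> \<tau> d < 2 * pi / m \<and> d * cis (\<tau> d) \<in> D"
      by metis
    obtain d0 where d0: "d0 \<in> D" using D by auto
    \<comment> \<open>\<open>p\<close> is the walk starting at \<open>d0\<close>, and
      \<open>s k\<close> is the angle covered in its first \<open>k\<close> steps.\<close>
    define p where "p k = ((\<lambda>d. d * cis (\<tau> d)) ^^ k) d0" for k
    define s where "s k = (\<Sum>i<k. \<tau> (p i))" for k
    have pD: "p k \<in> D" for k by (induction k) (auto simp: p_def d0 \<tau>)
    have p: "p k = d0 * cis (s k)" for k
    proof (induction k)
      case (Suc k)
      have "p (Suc k) = p k * cis (\<tau> (p k))" by (simp add: p_def)
      also have "\<dots> = d0 * cis (s k) * cis (\<tau> (p k))" by (simp flip: Suc)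
      also have "\<dots> = d0 * cis (s (Suc k))" by (simp add: s_def cis_mult)
      finally show ?case .
    qed (simp add: p_def s_def)
    \<comment> \<open>There are \<open>m + 1\<close> indices but at most \<open>m\<close>
      points.\<close>
    have "card (p ` {..m}) < card {..m}"
      using card_mono[OF D(1), of "p ` {..m}"] pD D(3) by fastforce
    then have "\<not> inj_on p {..m}" by (rule pigeonhole)
    then obtain i j where ij: "i < j" "j \<le> m" "p i = p j"
      by (auto simp: inj_on_def) (metis linorder_neqE_nat)
    have "s j = s i + (\<Sum>l\<in>{i..<j}. \<tau> (p l))"
      unfolding s_def using ij(1) by (simp add: lessThan_atLeast0 sum.atLeastLessThan_concat)
    moreover have "(\<Sum>l\<in>{i..<j}. \<tau> (p l)) > 0"
      by (intro sum_pos) (use ij \<tau> pD in auto)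
    moreover have "(\<Sum>l\<in>{i..<j}. \<tau> (p l)) < (\<Sum>l\<in>{i..<j}. 2 * pi / m)"
      by (intro sum_strict_mono) (use ij \<tau> pD in auto)
    moreover have "(\<Sum>l\<in>{i..<j}. 2 * pi / m) \<le> 2 * pi"
    proof -
      have "real (j - i) / m * (2 * pi) \<le> 1 * (2 * pi)"
        using ij m by (intro mult_right_mono) auto
      then show ?thesis by simp
    qed
    ultimately have s: "0 < s j - s i" "s j - s i < 2 * pi" by linarith+
    have "d0 \<noteq> 0" using D(4)[OF d0] by auto
    then have "cis (s j) = cis (s i)" using ij(3) p by simp
    then have "cis (s j - s i) = 1" by (simp flip: cis_divide)
    then have "cos (s j - s i) = 1" by (simp add: complex_eq_iff)
    then obtain n :: int where "s j - s i = real_of_int n * 2 * pi"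
      using cos_one_2pi_int by blast
    with s have "0 < real_of_int n" "real_of_int n < 1"
      by (simp_all add: zero_less_mult_iff)
    then show False by simp
  qed
  then obtain d where d: "d \<in> D" "\<And>t. 0 < t \<Longrightarrow> t < 2 * pi / m \<Longrightarrow> d * cis t \<notin> D" by blast
  \<comment> \<open>The witness is the midpoint of the free arc of length \<open>2 * pi / m\<close>
    that follows \<open>d\<close>.\<close>
  have "d * cis (pi / m) \<noteq> d' * cis t" if "d' \<in> D" "\<bar>t\<bar> < pi / m" for d' t
  proof
    assume "d * cis (pi / m) = d' * cis t"
    then have "d' = d * cis (pi / m - t)"
      by (simp add: field_simps flip: cis_divide)
    moreover have "0 < pi / m - t" "pi / m - t < 2 * pi / m"
      using that by (simp_all add: abs_less_iff)
    ultimately show False using d(2) that(1) by blast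
  qed
  moreover have "cmod (d * cis (pi / m)) = 1" using D(4) d(1) by (simp add: norm_mult)
  ultimately show ?thesis by blast
qed

section \<open>Spectra of commutators\<close>

lemma spectrum_nonempty:
  fixes M :: "complex ^'n ^'n"
  assumes "unitary M"
  shows "spectrum M \<noteq> {}"
proof
  assume "spectrum M = {}"
  then have "v = 0" for v :: "complex ^'n"
    using spectral_decomposition_unitary[OF assms, of v] by simp
  from this[of "vec 1"] show False by (simp add: vec_eq_iff)
qed

lemma cmod_spectrum_unitary: "unitary M \<Longrightarrow> l \<in> spectrum M \<Longrightarrow> cmod l = 1"
  by (auto simp: spectrum_def intro: norm_eigenvalue_unitary)

lemma spectrum_conj:
  assumes z: "unitary z" and l: "l \<in> spectrum (z ** g ** mat_adjoint z)"
  shows "l \<in> spectrum g"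
proof -
  obtain v where v: "v \<noteq> 0" "(z ** g ** mat_adjoint z) *v v = l *s v"
    using l by (auto simp: spectrum_def)
  define u where "u = mat_adjoint z *v v"
  have "z *v u = v" by (simp add: u_def unitary_vector_cancel z)
  then have "u \<noteq> 0" using v(1) by auto
  moreover have "z *v (g *v u) = l *s v"
    using v(2) by (simp add: u_def matrix_vector_mul_assoc matrix_mul_assoc)
  then have "g *v u = mat_adjoint z *v (l *s v)"
    using unitary_vector_cancel(2)[OF z] by metis
  then have "g *v u = l *s u" by (simp add: u_def vec.scale)
  ultimately show ?thesis by (auto simp: spectrum_def)
qed

lemma spectrum_adjoint:
  assumes g: "unitary g" and l: "l \<in> spectrum (mat_adjoint g)"
  shows "cnj l \<in> spectrum g"
proof -
  obtain v where v: "v \<noteq> 0" "mat_adjoint g *v v = l *s v"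
    using l by (auto simp: spectrum_def)
  with adjoint_eigenvector[OF unitary_adjoint[OF g] v(2,1)] show ?thesis
    by (auto simp: spectrum_def)
qed

text \<open>All diagonal quotients equal \<open>1\<close>, which leaves at most
  \<open>n\<^sup>2 - n + 1\<close> values. For \<open>n \<ge> 2\<close> this is below
  \<open>n\<^sup>2\<close>, and this strictness is what later leaves room on the circle.\<close>

lemma card_quotients_le:
  fixes S :: "complex set"
  assumes S: "finite S" "card S \<le> n" "n \<ge> 2" "\<And>a. a \<in> S \<Longrightarrow> cmod a = 1"
  shows "card {a * cnj b | a b. a \<in> S \<and> b \<in> S} \<le> n\<^sup>2 - 1"
proof -
  let ?P = "S \<times> S - (\<lambda>a. (a, a)) ` S"
  have "a * cnj a = 1" if "a \<in> S" for a
    using S(4)[OF that] complex_norm_square[of a] by simp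
  then have "{a * cnj b | a b. a \<in> S \<and> b \<in> S} \<subseteq> insert 1 ((\<lambda>(a, b). a * cnj b) ` ?P)"
    by (auto simp: image_iff)
  then have "card {a * cnj b | a b. a \<in> S \<and> b \<in> S} \<le> card (insert 1 ((\<lambda>(a, b). a * cnj b) ` ?P))"
    by (intro card_mono) (use S in auto)
  also have "\<dots> \<le> Suc (card ?P)"
    by (rule order.trans[OF card_insert_le_m1[of "Suc (card ?P)"]])
       (use S in \<open>auto intro!: card_image_le\<close>)
  also have "card ?P = card S * card S - card S"
    using S(1) by (subst card_Diff_subset) (auto simp: card_image inj_on_def)
  also have "Suc (card S * card S - card S) \<le> n\<^sup>2 - 1"
  proof -
    have "card S * card S - card S = card S * (card S - 1)" by (simp add: diff_mult_distrib2)
    also have "\<dots> \<le> n * (n - 1)" using S(2) by (intro mult_mono) auto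
    also have "\<dots> = n\<^sup>2 - n" by (simp add: diff_mult_distrib2 power2_eq_square)
    finally show ?thesis using S(3) self_le_power[of n 2] by simp
  qed
  finally show ?thesis .
qed

section \<open>Unitary groups: compact closure, centre and finiteness of the central
  quotient\<close>

locale unitary_matrix_group =
  fixes G :: "(complex ^'n ^'n) set"
  assumes grp: "unitary_group G"
begin

lemma unitary: "A \<in> G \<Longrightarrow> unitary A"
  using grp by (simp add: unitary_group_def)

lemma one_mem: "mat 1 \<in> G"
  using grp by (simp add: unitary_group_def)

lemma mult_mem: "A \<in> G \<Longrightarrow> B \<in> G \<Longrightarrow> A ** B \<in> G"
  using grp by (simp add: unitary_group_def)

lemma adjoint_mem: "A \<in> G \<Longrightarrow> mat_adjoint A \<in> G"
  using grp matrix_inv_unitary[OF unitary, of A] unfolding unitary_group_def by metis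

lemma closure_mult_mem:
  assumes "A \<in> closure G" "B \<in> closure G"
  shows "A ** B \<in> closure G"
proof -
  obtain a b where "\<And>j. a j \<in> G" "a \<longlonglongrightarrow> A" "\<And>j. b j \<in> G" "b \<longlonglongrightarrow> B"
    using assms unfolding closure_sequential by metis
  then show ?thesis
    unfolding closure_sequential by (intro exI[of _ "\<lambda>j. a j ** b j"]) (auto intro: mult_mem tendsto_intros)
qed

lemma closure_adjoint_mem:
  assumes "A \<in> closure G"
  shows "mat_adjoint A \<in> closure G"
proof -
  obtain a where "\<And>j. a j \<in> G" "a \<longlonglongrightarrow> A"
    using assms unfolding closure_sequential by metis
  then show ?thesis
    unfolding closure_sequential
    by (intro exI[of _ "\<lambda>j. mat_adjoint (a j)"]) (auto intro: adjoint_mem tendsto_intros)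
qed

lemma closure_unitary:
  assumes "A \<in> closure G"
  shows "unitary A"
proof -
  obtain a where a: "\<And>j. a j \<in> G" "a \<longlonglongrightarrow> A"
    using assms unfolding closure_sequential by metis
  have "(\<lambda>j. a j ** mat_adjoint (a j)) \<longlonglongrightarrow> A ** mat_adjoint A"
    "(\<lambda>j. mat_adjoint (a j) ** a j) \<longlonglongrightarrow> mat_adjoint A ** A"
    by (intro tendsto_intros a)+
  then have "A ** mat_adjoint A = mat 1" "mat_adjoint A ** A = mat 1"
    using unitary_cancel(1,2)[OF unitary[OF a(1)]] by (simp_all add: LIMSEQ_const_iff)
  then show ?thesis by (simp add: unitary_def)
qed

lemma norm_mem: "A \<in> G \<Longrightarrow> norm A = norm (mat 1 :: complex ^'n ^'n)"
  using norm_unitary_mult_left[OF unitary, of A "mat 1"] by simp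

lemma bounded_G: "bounded G"
  by (rule boundedI[of _ "norm (mat 1 :: complex ^'n ^'n)"]) (simp add: norm_mem)

lemma centre_mult_mem:
  assumes Y: "Y \<in> centre G" and Z: "Z \<in> centre G"
  shows "Y ** Z \<in> centre G"
proof -
  have "(Y ** Z) ** B = B ** (Y ** Z)" if "B \<in> G" for B
  proof -
    have "(Y ** Z) ** B = Y ** (Z ** B)" by (simp add: matrix_mul_assoc)
    also have "Z ** B = B ** Z" using Z that unfolding centre_def by blast
    also have "Y ** (B ** Z) = (Y ** B) ** Z" by (simp add: matrix_mul_assoc)
    also have "Y ** B = B ** Y" using Y that unfolding centre_def by blast
    finally show ?thesis by (simp add: matrix_mul_assoc)
  qed
  moreover have "Y ** Z \<in> G" using Y Z mult_mem unfolding centre_def by blast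
  ultimately show ?thesis unfolding centre_def by blast
qed

lemma centre_adjoint_mem:
  assumes Z: "Z \<in> centre G"
  shows "mat_adjoint Z \<in> centre G"
proof -
  have ZG: "Z \<in> G" using Z by (simp add: centre_def)
  have "mat_adjoint Z ** B = B ** mat_adjoint Z" if "B \<in> G" for B
  proof -
    have "Z ** B = B ** Z" using Z that unfolding centre_def by blast
    then have "mat_adjoint Z ** (Z ** B) ** mat_adjoint Z = mat_adjoint Z ** (B ** Z) ** mat_adjoint Z"
      by simp
    then show ?thesis
      by (simp add: unitary_cancel[OF unitary[OF ZG]] flip: matrix_mul_assoc)
  qed
  then show ?thesis using ZG adjoint_mem unfolding centre_def by blast
qed

text \<open>Finitely many \<open>\<epsilon>\<close>-balls with centres in \<open>G\<close> cover the
  compact closure. An element in the ball around \<open>f\<close> is \<open>f\<close> times an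
  element near \<open>mat 1\<close>, hence lies in the central coset of \<open>f\<close>.\<close>

lemma finite_quotient_if_near_one_central:
  assumes e: "\<epsilon> > 0"
    and central: "\<And>x. x \<in> G \<Longrightarrow> norm (x - mat 1) < \<epsilon> \<Longrightarrow> x \<in> centre G"
  shows "finite (quotient_by_centre G)"
proof -
  have cover: "closure G \<subseteq> (\<Union>f\<in>G. ball f \<epsilon>)"
    using e by (force simp: closure_approachable)
  have compact: "compact (closure G)" using bounded_G by simp
  obtain F where F: "F \<subseteq> G" "finite F" "closure G \<subseteq> (\<Union>f\<in>F. ball f \<epsilon>)"
    by (rule compactE_image[OF compact _ cover]) (rule open_ball)
  have "quotient_by_centre G \<subseteq> (\<lambda>A. (\<lambda>Z. A ** Z) ` centre G) ` F"
    unfolding quotient_by_centre_def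
  proof (rule image_subsetI)
    fix A assume A: "A \<in> G"
    then have "A \<in> (\<Union>f\<in>F. ball f \<epsilon>)" using F(3) closure_subset[of G] by blast
    then obtain f where f: "f \<in> F" "dist f A < \<epsilon>" by auto
    have fG: "f \<in> G" using f F by auto
    define z where "z = mat_adjoint f ** A"
    have "z - mat 1 = mat_adjoint f ** (A - f)"
      by (simp add: z_def matrix_mult_diff_right unitary_cancel unitary fG)
    then have "norm (z - mat 1) = norm (A - f)"
      by (simp add: norm_unitary_mult_left unitary_adjoint unitary fG)
    then have z: "z \<in> centre G"
      using central[of z] f(2) A fG by (simp add: z_def mult_mem adjoint_mem dist_norm norm_minus_commute)
    have Az: "A = f ** z" by (simp add: z_def unitary_cancel unitary fG)
    have zG: "z \<in> G" using z by (auto simp: centre_def)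
    note mz = centre_mult_mem[OF z] and mz' = centre_mult_mem[OF centre_adjoint_mem[OF z]]
    have "(\<lambda>Z. A ** Z) ` centre G = (\<lambda>Z. f ** Z) ` centre G"
    proof (intro equalityI image_subsetI)
      fix Z assume "Z \<in> centre G"
      then show "A ** Z \<in> (**) f ` centre G"
        using mz by (auto simp: Az simp flip: matrix_mul_assoc)
    next
      fix Z assume "Z \<in> centre G"
      moreover have "f ** Z = A ** (mat_adjoint z ** Z)"
        by (simp add: Az unitary_cancel unitary zG flip: matrix_mul_assoc)
      ultimately show "f ** Z \<in> (**) A ` centre G" using mz' by blast
    qed
    then show "(\<lambda>Z. A ** Z) ` centre G \<in> (\<lambda>A. (\<lambda>Z. A ** Z) ` centre G) ` F"
      using f(1) by blast
  qed
  then show ?thesis using F(2) finite_subset by blast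
qed

section \<open>Consequences of argument-submultiplicativity\<close>

text \<open>The eigenvalues lie within angle \<open>pi / n\<^sup>2\<close> of the set
  \<open>D\<close> of quotients, while \<open>circle_gap\<close> supplies a point \<open>w\<close>
  at angle at least \<open>pi / m\<close> from \<open>D\<close>, where
  \<open>m = n\<^sup>2 - 1\<close>. The order of quantifiers matters: \<open>\<delta>\<close> is
  uniform in \<open>g\<close>, and \<open>w\<close> is uniform in \<open>z\<close>.\<close>

lemma commutator_spectral_gap:
  assumes asm: "ASM (1 / (2 * real (CARD('n))^2)) G" and dim: "CARD('n) \<ge> 2"
  shows "\<exists>\<delta>>0. \<forall>g\<in>G. \<exists>w. cmod w = 1 \<and> (\<forall>z\<in>G. \<forall>v.
    \<delta> * norm v \<le> norm ((z ** g ** mat_adjoint z ** mat_adjoint g) *v v - w *s v))"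
proof -
  define n where "n = CARD('n)"
  define m where "m = n\<^sup>2 - 1"
  \<comment> \<open>The angular margin between the gap and the tolerance of the hypothesis;
    \<open>\<delta>\<close> is a corresponding distance in the plane.\<close>
  define \<eta> where "\<eta> = pi / m - pi / (real n)\<^sup>2"
  have n: "n \<ge> 2" using dim by (simp add: n_def)
  have "n\<^sup>2 > 1" using n by (intro one_less_power) auto
  then have m: "m > 0" "real m < (real n)\<^sup>2" by (auto simp: m_def of_nat_diff)
  then have "\<eta> > 0" unfolding \<eta>_def by (simp add: frac_less2)
  then obtain \<delta> where \<delta>: "\<delta> > 0" "\<And>z. cmod (z - 1) < \<delta> \<Longrightarrow> \<bar>Arg z\<bar> < \<eta>"
    using Arg_small_near_one by blast
  show ?thesis
  proof (intro exI[of _ \<delta>] conjI ballI)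
    fix g assume g: "g \<in> G"
    define D where "D = {a * cnj b | a b. a \<in> spectrum g \<and> b \<in> spectrum g}"
    have fin: "finite (spectrum g)" "card (spectrum g) \<le> n"
      using finite_spectrum_unitary[OF unitary[OF g]] by (auto simp: n_def)
    have unit: "\<And>a. a \<in> spectrum g \<Longrightarrow> cmod a = 1"
      using cmod_spectrum_unitary unitary[OF g] by blast
    have D: "finite D" "D \<noteq> {}" "card D \<le> m" "\<And>d. d \<in> D \<Longrightarrow> cmod d = 1"
    proof -
      show "finite D" unfolding D_def using fin by (simp add: finite_image_set2)
      show "D \<noteq> {}" unfolding D_def using spectrum_nonempty[OF unitary[OF g]] by auto
      show "card D \<le> m" unfolding D_def m_def using fin n unit by (rule card_quotients_le)
      show "\<And>d. d \<in> D \<Longrightarrow> cmod d = 1" unfolding D_def using unit by (auto simp: norm_mult)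
    qed
    obtain w where w: "cmod w = 1" "\<And>d t. d \<in> D \<Longrightarrow> \<bar>t\<bar> < pi / m \<Longrightarrow> w \<noteq> d * cis t"
      using circle_gap[OF D] by blast
    have "\<delta> * norm v \<le> norm ((z ** g ** mat_adjoint z ** mat_adjoint g) *v v - w *s v)"
      if z: "z \<in> G" for z v
    proof (rule norm_residual_unitary)
      let ?A = "z ** g ** mat_adjoint z" and ?B = "mat_adjoint g"
      have AB: "?A \<in> G" "?B \<in> G" using z g mult_mem adjoint_mem by auto
      then show U: "unitary (?A ** ?B)" using unitary mult_mem by blast
      fix c assume c: "c \<in> spectrum (?A ** ?B)"
      then obtain a b where ab: "a \<in> spectrum ?A" "b \<in> spectrum ?B"
        "\<bar>Arg (a * b / c)\<bar> / (2 * pi) \<le> 1 / (2 * (real n)\<^sup>2)"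
        using asm AB unfolding ASM_def n_def by blast
      have d: "a * b \<in> D"
        using spectrum_conj[OF unitary[OF z] ab(1)] spectrum_adjoint[OF unitary[OF g] ab(2)]
        unfolding D_def by (metis (mono_tags, lifting) complex_cnj_cnj mem_Collect_eq)
      have c1: "cmod c = 1" using cmod_spectrum_unitary[OF U c] .
      show "\<delta> \<le> cmod (c - w)"
      proof (rule ccontr)
        assume "\<not> ?thesis"
        moreover have "cmod (c / w - 1) = cmod (c - w)"
        proof -
          have "w \<noteq> 0" using w(1) by auto
          then have "c / w - 1 = (c - w) / w" by (simp add: field_simps)
          then show ?thesis using w(1) by (simp add: norm_divide)
        qed
        ultimately have 1: "\<bar>Arg (c / w)\<bar> < \<eta>" using \<delta>(2) by simp
        have 2: "\<bar>Arg (a * b / c)\<bar> \<le> pi / (real n)\<^sup>2"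
          using ab(3) n by (simp add: field_simps)
        have "cis (Arg (c / w)) = c / w" "cis (Arg (a * b / c)) = a * b / c"
          using c1 w(1) D(4)[OF d] by (auto intro!: cis_Arg_unit simp: norm_divide)
        then have "cis (- (Arg (c / w) + Arg (a * b / c))) = inverse (c / w * (a * b / c))"
          by (metis cis_inverse cis_mult)
        moreover have "a * b \<noteq> 0" "c \<noteq> 0" using D(4)[OF d] c1 by auto
        \<comment> \<open>An eigenvalue \<open>c\<close> too close to \<open>w\<close> would bring
          \<open>w\<close> within angle \<open>pi / m\<close> of the point \<open>a * b\<close> of
          \<open>D\<close>.\<close>
        ultimately have "w = (a * b) * cis (- (Arg (c / w) + Arg (a * b / c)))"
          by (simp add: field_simps)
        moreover have "\<bar>- (Arg (c / w) + Arg (a * b / c))\<bar> < pi / m"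
          using 1 2 unfolding \<eta>_def by linarith
        ultimately show False using w(2)[OF d] by blast
      qed
    qed (use \<delta> in simp)
    with w(1) show "\<exists>w. cmod w = 1 \<and> (\<forall>z\<in>G. \<forall>v.
      \<delta> * norm v \<le> norm ((z ** g ** mat_adjoint z ** mat_adjoint g) *v v - w *s v))"
      by blast
  qed (fact \<delta>(1))
qed

text \<open>For \<open>g\<close> a limit of group elements, their gap points accumulate on the
  circle. With \<open>z\<close> and \<open>v\<close> fixed, the inequality passes to the limit with
  the same \<open>\<delta>\<close>.\<close>

lemma commutator_spectral_gap_closure:
  assumes asm: "ASM (1 / (2 * real (CARD('n))^2)) G" and dim: "CARD('n) \<ge> 2"
  shows "\<exists>\<delta>>0. \<forall>g\<in>closure G. \<exists>w. cmod w = 1 \<and> (\<forall>z\<in>G. \<forall>v.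
    \<delta> * norm v \<le> norm ((z ** g ** mat_adjoint z ** mat_adjoint g) *v v - w *s v))"
proof -
  obtain \<delta> W where \<delta>: "\<delta> > 0" and W: "\<And>g. g \<in> G \<Longrightarrow> cmod (W g) = 1"
    "\<And>g z v. g \<in> G \<Longrightarrow> z \<in> G \<Longrightarrow>
      \<delta> * norm v \<le> norm ((z ** g ** mat_adjoint z ** mat_adjoint g) *v v - W g *s v)"
    using commutator_spectral_gap[OF asm dim] by metis
  show ?thesis
  proof (intro exI[of _ \<delta>] conjI ballI)
    fix g assume "g \<in> closure G"
    then obtain h where h: "\<And>j. h j \<in> G" "h \<longlonglongrightarrow> g"
      unfolding closure_sequential by blast
    have "compact (sphere (0::complex) 1)" by simp
    moreover have "\<forall>j. W (h j) \<in> sphere 0 1" using W(1) h(1) by simp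
    ultimately obtain w r where w: "w \<in> sphere 0 1" "strict_mono r" "((\<lambda>j. W (h j)) \<circ> r) \<longlonglongrightarrow> w"
      unfolding compact_def by metis
    have hr: "(\<lambda>j. h (r j)) \<longlonglongrightarrow> g"
      using LIMSEQ_subseq_LIMSEQ[OF h(2) w(2)] by (simp add: o_def)
    have wr: "(\<lambda>j. W (h (r j))) \<longlonglongrightarrow> w" using w(3) by (simp add: o_def)
    have "\<delta> * norm v \<le> norm ((z ** g ** mat_adjoint z ** mat_adjoint g) *v v - w *s v)"
      if "z \<in> G" for z v
    proof (rule LIMSEQ_le_const)
      show "(\<lambda>j. norm ((z ** h (r j) ** mat_adjoint z ** mat_adjoint (h (r j))) *v v - W (h (r j)) *s v))
        \<longlonglongrightarrow> norm ((z ** g ** mat_adjoint z ** mat_adjoint g) *v v - w *s v)"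
        by (intro tendsto_intros hr wr)
    qed (use W(2) h(1) that in blast)
    with w(1) show "\<exists>w. cmod w = 1 \<and> (\<forall>z\<in>G. \<forall>v.
      \<delta> * norm v \<le> norm ((z ** g ** mat_adjoint z ** mat_adjoint g) *v v - w *s v))"
      by auto
  qed (fact \<delta>)
qed

lemma near_one_central:
  assumes asm: "ASM (1 / (2 * real (CARD('n))^2)) G" and dim: "CARD('n) \<ge> 2"
  shows "\<exists>\<epsilon>>0. \<forall>x\<in>G. norm (x - mat 1) < \<epsilon> \<longrightarrow> x \<in> centre G"
proof -
  obtain \<delta> W where \<delta>: "\<delta> > 0" and W: "\<And>g. g \<in> closure G \<Longrightarrow> cmod (W g) = 1"
    "\<And>g z v. g \<in> closure G \<Longrightarrow> z \<in> G \<Longrightarrow>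
      \<delta> * norm v \<le> norm ((z ** g ** mat_adjoint z ** mat_adjoint g) *v v - W g *s v)"
    using commutator_spectral_gap_closure[OF asm dim] by metis
  obtain \<delta>' where \<delta>': "\<delta>' > 0" "\<And>z. cmod (z - 1) < \<delta>' \<Longrightarrow> \<bar>Arg z\<bar> < \<delta>"
    using Arg_small_near_one[OF \<delta>] by blast
  \<comment> \<open>\<open>1/4\<close> serves \<open>inner_conj_commutator_less\<close>. The half is
    there because \<open>c - mat 1\<close> has the norm of \<open>x - y\<close>, at most the sum of
    two equal distances from \<open>mat 1\<close>.\<close>
  define \<epsilon> where "\<epsilon> = min (1/4) (\<delta>' / 2)"
  have "x \<in> centre G" if x: "x \<in> G" and small: "norm (x - mat 1) < \<epsilon>" for x
  proof -
    have ux: "unitary x" using unitary x .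
    have "continuous_on (closure G) (\<lambda>g. x \<bullet> (g ** x ** mat_adjoint g))"
      unfolding continuous_on_def by (intro ballI tendsto_intros)
    moreover have "compact (closure G)" using bounded_G by simp
    moreover have "closure G \<noteq> {}" using x closure_subset by blast
    \<comment> \<open>All conjugates of \<open>x\<close> have the same norm, so a minimal inner
      product means a maximal distance from \<open>x\<close>.\<close>
    ultimately have "\<exists>g\<in>closure G. \<forall>h\<in>closure G.
        x \<bullet> (g ** x ** mat_adjoint g) \<le> x \<bullet> (h ** x ** mat_adjoint h)"
      by (intro continuous_attains_inf)
    then obtain g where g: "g \<in> closure G"
      and min: "\<And>h. h \<in> closure G \<Longrightarrow> x \<bullet> (g ** x ** mat_adjoint g) \<le> x \<bullet> (h ** x ** mat_adjoint h)"
      by blast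
    have ug: "unitary g" using closure_unitary g .
    define y where "y = g ** x ** mat_adjoint g"
    have xc: "x \<in> closure G" using x closure_subset by blast
    have yc: "y \<in> closure G"
      unfolding y_def by (intro closure_mult_mem closure_adjoint_mem g xc)
    have uy: "unitary y" using closure_unitary yc .
    have ny: "norm (y - mat 1) = norm (x - mat 1)"
      unfolding y_def by (rule norm_unitary_conj_diff_one[OF ug])
    have comm: "x ** y = y ** x"
    proof (rule ccontr)
      assume ne: "x ** y \<noteq> y ** x"
      define k where "k = x ** y ** mat_adjoint x ** mat_adjoint y"
      have "x \<bullet> (k ** y ** mat_adjoint k) < x \<bullet> y"
        unfolding k_def by (rule inner_conj_commutator_less[OF ux uy _ _ ne])
          (use small ny in \<open>auto simp: \<epsilon>_def\<close>)
      \<comment> \<open>Conjugating \<open>y\<close> by \<open>k\<close> is conjugating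
        \<open>x\<close> by \<open>k ** g\<close>, which competes with \<open>g\<close> in the
        minimisation.\<close>
      moreover have "k ** g \<in> closure G"
        unfolding k_def by (intro closure_mult_mem closure_adjoint_mem g xc yc)
      from min[OF this] have "x \<bullet> y \<le> x \<bullet> (k ** y ** mat_adjoint k)"
        by (simp add: y_def mat_adjoint_mult matrix_mul_assoc)
      ultimately show False by simp
    qed
    define c where "c = x ** mat_adjoint y"
    have uc: "unitary c" unfolding c_def by (intro unitary_mult unitary_adjoint ux uy)
    have comm': "mat_adjoint y ** x = x ** mat_adjoint y"
    proof -
      have "mat_adjoint y ** (x ** y) ** mat_adjoint y = mat_adjoint y ** (y ** x) ** mat_adjoint y"
        by (simp only: comm)
      then show ?thesis
        by (simp add: unitary_cancel[OF uy] flip: matrix_mul_assoc)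
    qed
    have c1: "c = mat 1"
    proof (rule unitary_eq_one[OF uc])
      fix l assume l: "l \<in> spectrum c"
      then obtain v where v: "v \<noteq> 0" "c *v v = l *s v" by (auto simp: spectrum_def)
      define Q where "Q z = z ** g ** mat_adjoint z ** mat_adjoint g" for z
      have l1: "cmod l = 1" using cmod_spectrum_unitary[OF uc l] .
      \<comment> \<open>The element \<open>z\<close> built here is the power \<open>x^k\<close>.
        Commutation with the adjoint of \<open>y\<close> is carried along because it turns
        \<open>Q (x ** z)\<close> into \<open>c ** Q z\<close>.\<close>
      have powers: "\<exists>z\<in>G. Q z *v v = (l ^ k) *s v \<and> Q z ** mat_adjoint y = mat_adjoint y ** Q z" for k
      proof (induction k)
        case 0
        show ?case
          by (rule bexI[OF _ one_mem]) (simp add: Q_def unitary_cancel ug)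
      next
        case (Suc k)
        then obtain z where z: "z \<in> G" "Q z *v v = (l ^ k) *s v"
          "Q z ** mat_adjoint y = mat_adjoint y ** Q z" by blast
        have "Q (x ** z) = x ** (Q z ** mat_adjoint y)"
          by (simp add: Q_def y_def mat_adjoint_mult unitary_cancel[OF ug] flip: matrix_mul_assoc)
        then have Q: "Q (x ** z) = c ** Q z"
          by (simp add: z(3) c_def matrix_mul_assoc)
        have "Q (x ** z) *v v = c *v (Q z *v v)"
          by (simp add: Q matrix_vector_mul_assoc)
        also have "\<dots> = (l ^ Suc k) *s v"
          by (simp add: z(2) v(2) vec.scale mult.commute)
        finally have 1: "Q (x ** z) *v v = (l ^ Suc k) *s v" .
        have "Q (x ** z) ** mat_adjoint y = c ** (mat_adjoint y ** Q z)"
          by (simp add: Q z(3) flip: matrix_mul_assoc)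
        also have "\<dots> = (mat_adjoint y ** x) ** mat_adjoint y ** Q z"
          by (simp only: c_def comm' matrix_mul_assoc)
        also have "\<dots> = mat_adjoint y ** Q (x ** z)"
          by (simp add: Q c_def flip: matrix_mul_assoc)
        finally show ?case using 1 mult_mem[OF x z(1)] by blast
      qed
      show "l = 1"
      proof (rule ccontr)
        assume "l \<noteq> 1"
        have "c - mat 1 = (x - y) ** mat_adjoint y"
          by (simp add: c_def matrix_mult_diff_left unitary_cancel uy)
        then have "norm (c - mat 1) = norm (x - y)"
          by (simp add: norm_unitary_mult_right unitary_adjoint uy)
        also have "\<dots> \<le> norm (x - mat 1) + norm (y - mat 1)"
          using norm_triangle_ineq4[of "x - mat 1" "y - mat 1"] by simp
        also have "\<dots> < \<delta>'" using small by (simp add: ny \<epsilon>_def)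
        finally have "norm (c - mat 1) < \<delta>'" .
        moreover have "cmod (l - 1) * norm v \<le> norm (c - mat 1) * norm v"
        proof -
          have "(l - 1) *s v = (c - mat 1) *v v"
            by (simp add: v matrix_vector_mult_diff_rdistrib)
          then show ?thesis by (metis norm_matrix_vector_mult_le norm_scale)
        qed
        ultimately have "cmod (l - 1) < \<delta>'" using v(1) by simp
        then have A: "\<bar>Arg l\<bar> < \<delta>" by (rule \<delta>'(2))
        \<comment> \<open>The powers of \<open>l\<close> move in nonzero steps shorter than
          \<open>\<delta>\<close>, so one comes closer than \<open>\<delta>\<close> to
          \<open>W g\<close>, although it is an eigenvalue of some \<open>Q z\<close>.\<close>
        have "Arg l \<noteq> 0" using cis_Arg_unit[OF l1] \<open>l \<noteq> 1\<close> by auto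
        then obtain k where "cmod (l ^ k - W g) \<le> \<bar>Arg l\<bar>"
          using cis_powers_dense[OF _ W(1)[OF g], of "Arg l"] cis_Arg_unit[OF l1] by auto
        moreover obtain z where "z \<in> G" "Q z *v v = (l ^ k) *s v"
          using powers by blast
        then have "\<delta> * norm v \<le> cmod (l ^ k - W g) * norm v"
          using W(2)[OF g, of z v] unfolding Q_def by (simp flip: vector_sub_rdistrib norm_scale)
        then have "\<delta> \<le> cmod (l ^ k - W g)" using v(1) by simp
        ultimately show False using A by simp
      qed
    qed
    have "x = y"
    proof -
      have "x = c ** y" by (simp add: c_def unitary_cancel[OF uy] flip: matrix_mul_assoc)
      then show ?thesis by (simp add: c1)
    qed
    have "h ** x = x ** h" if h: "h \<in> G" for h
    proof -
      let ?y = "h ** x ** mat_adjoint h"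
      have uh: "unitary h" using unitary h .
      \<comment> \<open>Since \<open>x = y\<close>, the minimum is \<open>x \<bullet> x\<close>, the
        largest value possible for vectors of this norm. Every conjugate of \<open>x\<close> by an
        element of \<open>G\<close> therefore equals \<open>x\<close>.\<close>
      have "x \<bullet> x \<le> x \<bullet> ?y"
        using min[of h] h closure_subset \<open>x = y\<close> unfolding y_def[symmetric] by auto
      moreover have "norm ?y = norm x"
        by (simp add: norm_unitary_mult_left norm_unitary_mult_right unitary_adjoint uh)
      ultimately have "(norm (x - ?y))\<^sup>2 \<le> 0"
        using inner_eq_of_norm_diff[of x ?y] by (simp add: power2_norm_eq_inner[of x])
      then have "x = ?y" by simp
      then have "x ** h = ?y ** h" by simp
      then show ?thesis by (simp add: unitary_cancel[OF uh] flip: matrix_mul_assoc)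
    qed
    with x show ?thesis unfolding centre_def by force
  qed
  moreover have "\<epsilon> > 0" using \<delta>'(1) by (simp add: \<epsilon>_def)
  ultimately show ?thesis by blast
qed

end

theorem theorem6:
  fixes G :: "(complex ^'n ^'n) set"
  assumes "unitary_group G"
    and "ASM (1 / (2 * real (CARD('n))^2)) G"
  shows "finite (quotient_by_centre G)"
proof -
  interpret unitary_matrix_group G by unfold_locales (fact assms(1))
  show ?thesis
  proof (cases "CARD('n) \<ge> 2")
    case True
    then show ?thesis
      using near_one_central[OF assms(2)] finite_quotient_if_near_one_central by blast
  next
    case False
    then have "CARD('n) = 1" using zero_less_card_finite[where 'a='n] by linarith
    then obtain a :: 'n where a: "UNIV = {a}" using card_1_singletonE by blast
    then have ia: "i = a" for i :: 'n by auto
    then have "A ** B = B ** A" for A B :: "complex ^'n ^'n"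
      by (simp add: vec_eq_iff matrix_matrix_mult_def a) (metis ia mult.commute)
    then have "centre G = G" by (auto simp: centre_def)
    then show ?thesis
      by (intro finite_quotient_if_near_one_central[of 1]) auto
  qed
qed

end
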